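(* Let $\Gamma=(G,\sigma)$ be a signed graph and $v\in V(G)$ any one of its vertices, and let $F(\Gamma,v)$ be the Fowler construction for signed graphs. The following statements hold: (1) $F(\Gamma,v)$ is a signed nut graph if and only if $\Gamma$ is a signed nut graph. (2) $F(\Gamma,v)$ is a sign-balanced nut graph if and only if $\Gamma$ is a sign-balanced nut graph.
   Context: A signed graph $\Gamma=(G,\sigma)$ is a finite simple graph $G=(V,E)$ with a map $\sigma:E\to\{-1,+1\}$; equivalently $\Gamma=(G,\Sigma)$ with $\Sigma=\{e:\sigma(e)=-1\}$. Its adjacency matrix $A(\Gamma)$ has entry $\sigma(uw)$ for each edge $uw\in E$ and $0$ elsewhere. A vector is full if it has no zero entry. $\Gamma$ is a signed nut graph if $\dim\ker A(\Gamma)=1$ and $\ker A(\Gamma)$ contains a full vector. Switching $\Gamma$ at $U\subseteq V$ produces $\Gamma^U=(G,\Sigma\,\triangle\,\partial U)$, where $\triangle$ is symmetric difference and $\partial U=\{uw\in E: u\in U, w\notin U\}$; two signed graphs over the same $G$ are switching equivalent if one is obtained from the other by a switching. $\Gamma=(G,\Sigma)$ is sign-balanced if it is switching equivalent to $(G,\emptyset)$. A sign-balanced nut graph is a signed nut graph that is sign-balanced. Fowler construction. Let $v$ be a vertex of $G$ of degree $\rho$ with neighbours $u_1,\dots,u_\rho$. The graph $F(G,v)$ has vertex set $V(G)\sqcup\{q_1,\dots,q_\rho\}\sqcup\{p_1,\dots,p_\rho\}$ and edge set $$(E(G)\setminus\{vu_i\mid 1\le i\le\rho\})\cup\{q_ip_j\mid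 1\le i,j\le\rho,\ i\ne j\}\cup\{vq_i\mid 1\le i\le\rho\}\cup\{p_iu_i\mid 1\le i\le\rho\}.$$ The signed graph $F(\Gamma,v)=(F(G,v),\sigma')$ has $\sigma'(vq_i)=1$, $\sigma'(q_ip_j)=1$, $\sigma'(p_iu_i)=\sigma(vu_i)$, and $\sigma'(e)=\sigma(e)$ for all other edges $e$. *)

theory Defs
  imports Complex_Main "HOL-Library.Function_Algebras"
begin

record 'a graph =
  verts :: "'a set"
  edges :: "'a set set"

record 'a sgraph = "'a graph" +
  sign :: "'a set \<Rightarrow> int"

definition simple_graph :: "('a, 'b) graph_scheme \<Rightarrow> bool" where
  "simple_graph G \<longleftrightarrow> finite (verts G) \<and>
     (\<forall>e\<in>edges G. \<exists>u\<in>verts G. \<exists>w\<in>verts G. u \<noteq> w \<and> e = {u, w})"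

text \<open>Values of \<^const>\<open>sign\<close> outside the edge set are irrelevant.\<close>

definition signed_graph :: "'a sgraph \<Rightarrow> bool" where
  "signed_graph \<Gamma> \<longleftrightarrow> simple_graph \<Gamma> \<and> (\<forall>e\<in>edges \<Gamma>. sign \<Gamma> e \<in> {-1, 1})"

definition neighbours :: "('a, 'b) graph_scheme \<Rightarrow> 'a \<Rightarrow> 'a set" where
  "neighbours G v = {w \<in> verts G. {v, w} \<in> edges G}"

definition degree :: "('a, 'b) graph_scheme \<Rightarrow> 'a \<Rightarrow> nat" where
  "degree G v = card (neighbours G v)"

definition adjacency :: "'a sgraph \<Rightarrow> 'a \<Rightarrow> 'a \<Rightarrow> real" where
  "adjacency \<Gamma> u w = (if {u, w} \<in> edges \<Gamma> then real_of_int (sign \<Gamma> {u, w}) else 0)"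

text \<open>Real vectors indexed by the vertices are represented by the functions that vanish
  outside \<^term>\<open>verts \<Gamma>\<close>; addition of functions is pointwise.\<close>

definition kernel :: "'a sgraph \<Rightarrow> ('a \<Rightarrow> real) set" where
  "kernel \<Gamma> = {x. (\<forall>u. u \<notin> verts \<Gamma> \<longrightarrow> x u = 0) \<and>
     (\<forall>u\<in>verts \<Gamma>. (\<Sum>w\<in>verts \<Gamma>. adjacency \<Gamma> u w * x w) = 0)}"

definition scale_fun :: "real \<Rightarrow> ('a \<Rightarrow> real) \<Rightarrow> 'a \<Rightarrow> real" where
  "scale_fun c x = (\<lambda>u. c * x u)"

lemma vector_space_scale_fun: "vector_space (scale_fun :: real \<Rightarrow> ('a \<Rightarrow> real) \<Rightarrow> 'a \<Rightarrow> real)"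
  by unfold_locales (auto simp: scale_fun_def algebra_simps fun_eq_iff)

definition nullity :: "'a sgraph \<Rightarrow> nat" where
  "nullity \<Gamma> = vector_space.dim scale_fun (kernel \<Gamma>)"

definition full :: "'a sgraph \<Rightarrow> ('a \<Rightarrow> real) \<Rightarrow> bool" where
  "full \<Gamma> x \<longleftrightarrow> (\<forall>u\<in>verts \<Gamma>. x u \<noteq> 0)"

definition signed_nut :: "'a sgraph \<Rightarrow> bool" where
  "signed_nut \<Gamma> \<longleftrightarrow> signed_graph \<Gamma> \<and> nullity \<Gamma> = 1 \<and> (\<exists>x\<in>kernel \<Gamma>. full \<Gamma> x)"

definition neg_edges :: "'a sgraph \<Rightarrow> 'a set set" where
  "neg_edges \<Gamma> = {e \<in> edges \<Gamma>. sign \<Gamma> e = -1}"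

definition signed_by :: "('a, 'b) graph_scheme \<Rightarrow> 'a set set \<Rightarrow> 'a sgraph" where
  "signed_by G S = \<lparr>verts = verts G, edges = edges G, sign = (\<lambda>e. if e \<in> S then -1 else 1)\<rparr>"

definition boundary :: "('a, 'b) graph_scheme \<Rightarrow> 'a set \<Rightarrow> 'a set set" where
  "boundary G U = {e \<in> edges G. \<exists>u w. e = {u, w} \<and> u \<in> U \<and> w \<notin> U}"

definition switch :: "'a sgraph \<Rightarrow> 'a set \<Rightarrow> 'a sgraph" where
  "switch \<Gamma> U = signed_by \<Gamma> (sym_diff (neg_edges \<Gamma>) (boundary \<Gamma> U))"

definition same_sgraph :: "'a sgraph \<Rightarrow> 'a sgraph \<Rightarrow> bool" where
  "same_sgraph \<Gamma> \<Delta> \<longleftrightarrow>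
     verts \<Gamma> = verts \<Delta> \<and> edges \<Gamma> = edges \<Delta> \<and> neg_edges \<Gamma> = neg_edges \<Delta>"

definition switching_equivalent :: "'a sgraph \<Rightarrow> 'a sgraph \<Rightarrow> bool" where
  "switching_equivalent \<Gamma> \<Delta> \<longleftrightarrow> (\<exists>U. U \<subseteq> verts \<Gamma> \<and> same_sgraph (switch \<Gamma> U) \<Delta>)"

definition sign_balanced :: "'a sgraph \<Rightarrow> bool" where
  "sign_balanced \<Gamma> \<longleftrightarrow> switching_equivalent \<Gamma> (signed_by \<Gamma> {})"

definition sign_balanced_nut :: "'a sgraph \<Rightarrow> bool" where
  "sign_balanced_nut \<Gamma> \<longleftrightarrow> signed_nut \<Gamma> \<and> sign_balanced \<Gamma>"

datatype 'a fowler_vertex = Old 'a | Q nat | P nat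

text \<open>The argument \<open>u\<close> lists the neighbours of \<open>v\<close> as \<open>u 1, \<dots>, u \<rho>\<close>, where \<open>\<rho>\<close> is the
  degree of \<open>v\<close>.\<close>

definition fowler_graph ::
  "('a, 'b) graph_scheme \<Rightarrow> 'a \<Rightarrow> (nat \<Rightarrow> 'a) \<Rightarrow> 'a fowler_vertex graph" where
  "fowler_graph G v u = (let I = {1..degree G v} in
     \<lparr>verts = Old ` verts G \<union> Q ` I \<union> P ` I,
      edges = (`) Old ` (edges G - {{v, u i} |i. i \<in> I})
        \<union> {{Q i, P j} |i j. i \<in> I \<and> j \<in> I \<and> i \<noteq> j}
        \<union> {{Old v, Q i} |i. i \<in> I}
        \<union> {{P i, Old (u i)} |i. i \<in> I}\<rparr>)"

text \<open>In the first case below \<^term>\<open>Old -` e\<close> is \<open>{u i}\<close>, in the second it is the edge of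
  \<open>\<Gamma>\<close> that \<open>e\<close> is a copy of.\<close>

definition fowler :: "'a sgraph \<Rightarrow> 'a \<Rightarrow> (nat \<Rightarrow> 'a) \<Rightarrow> 'a fowler_vertex sgraph" where
  "fowler \<Gamma> v u =
     \<lparr>verts = verts (fowler_graph \<Gamma> v u),
      edges = edges (fowler_graph \<Gamma> v u),
      sign = (\<lambda>e.
        if \<exists>i\<in>{1..degree \<Gamma> v}. e = {P i, Old (u i)} then sign \<Gamma> (insert v (Old -` e))
        else if e \<in> (`) Old ` edges \<Gamma> then sign \<Gamma> (Old -` e)
        else 1)\<rparr>"

lemma vimage_Old [simp]:
  "Old -` {} = {}" "Old -` insert (Old x) A = insert x (Old -` A)"
  "Old -` insert (Q i) A = Old -` A" "Old -` insert (P i) A = Old -` A"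
  by auto

lemma fowler_sign_vq: "sign (fowler \<Gamma> v u) {Old v, Q i} = 1"
  by (auto simp: fowler_def doubleton_eq_iff)

lemma fowler_sign_qp: "sign (fowler \<Gamma> v u) {Q i, P j} = 1"
  by (auto simp: fowler_def doubleton_eq_iff)

lemma fowler_sign_pu:
  "i \<in> {1..degree \<Gamma> v} \<Longrightarrow> sign (fowler \<Gamma> v u) {P i, Old (u i)} = sign \<Gamma> {v, u i}"
  by (auto simp: fowler_def)

lemma fowler_sign_old:
  assumes "e \<in> edges \<Gamma>"
  shows "sign (fowler \<Gamma> v u) (Old ` e) = sign \<Gamma> e"
proof -
  have "P i \<notin> Old ` e" for i
    by auto
  then have "\<not> (\<exists>i\<in>{1..degree \<Gamma> v}. Old ` e = {P i, Old (u i)})"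
    by (metis insertI1)
  moreover have "Old ` e \<in> (`) Old ` edges \<Gamma>"
    using assms by (rule imageI)
  moreover have "Old -` Old ` e = e"
    by (rule inj_vimage_image_eq) (simp add: inj_def)
  ultimately show ?thesis
    by (simp only: fowler_def sgraph.simps if_False if_True)
qed

lemma signed_graph_fowler:
  assumes G: "signed_graph \<Gamma>" and v: "v \<in> verts \<Gamma>"
    and u: "bij_betw u {1..degree \<Gamma> v} (neighbours \<Gamma> v)"
  shows "signed_graph (fowler \<Gamma> v u)"
proof -
  have uv: "u i \<in> verts \<Gamma>" "{v, u i} \<in> edges \<Gamma>" if "i \<in> {1..degree \<Gamma> v}" for i
    using bij_betwE[OF u] that by (auto simp: neighbours_def)
  let ?F = "fowler_graph \<Gamma> v u"
  have E: "edges ?F = (`) Old ` (edges \<Gamma> - {{v, u i} |i. i \<in> {1..degree \<Gamma> v}})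
        \<union> {{Q i, P j} |i j. i \<in> {1..degree \<Gamma> v} \<and> j \<in> {1..degree \<Gamma> v} \<and> i \<noteq> j}
        \<union> {{Old v, Q i} |i. i \<in> {1..degree \<Gamma> v}}
        \<union> {{P i, Old (u i)} |i. i \<in> {1..degree \<Gamma> v}}"
    and V: "verts ?F = Old ` verts \<Gamma> \<union> Q ` {1..degree \<Gamma> v} \<union> P ` {1..degree \<Gamma> v}"
    by (simp_all add: fowler_graph_def Let_def)
  have VO: "Old a \<in> verts ?F" if "a \<in> verts \<Gamma>" for a
    using that by (simp add: V)
  have VQ: "Q i \<in> verts ?F" if "i \<in> {1..degree \<Gamma> v}" for i
    using that unfolding V by blast
  have VP: "P i \<in> verts ?F" if "i \<in> {1..degree \<Gamma> v}" for i
    using that unfolding V by blast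
  have edge: "\<exists>a\<in>verts ?F. \<exists>b\<in>verts ?F. a \<noteq> b \<and> e = {a, b}"
    if "c \<in> verts ?F" "d \<in> verts ?F" "c \<noteq> d" "e = {c, d}" for c d e
    using that by blast
  have "\<exists>a\<in>verts ?F. \<exists>b\<in>verts ?F. a \<noteq> b \<and> e = {a, b}" if "e \<in> edges ?F" for e
    using that unfolding E
  proof (elim UnE)
    assume "e \<in> (`) Old ` (edges \<Gamma> - {{v, u i} |i. i \<in> {1..degree \<Gamma> v}})"
    then obtain e0 where e0: "e0 \<in> edges \<Gamma>" "e = Old ` e0" by blast
    obtain a b where ab: "a \<in> verts \<Gamma>" "b \<in> verts \<Gamma>" "a \<noteq> b" "e0 = {a, b}"
      using G e0(1) by (auto simp: signed_graph_def simple_graph_def)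
    show ?thesis by (rule edge[OF VO[OF ab(1)] VO[OF ab(2)]]) (simp_all add: ab e0)
  next
    assume "e \<in> {{Q i, P j} |i j. i \<in> {1..degree \<Gamma> v} \<and> j \<in> {1..degree \<Gamma> v} \<and> i \<noteq> j}"
    then obtain i j where ij: "i \<in> {1..degree \<Gamma> v}" "j \<in> {1..degree \<Gamma> v}" and e: "e = {Q i, P j}"
      by blast
    show ?thesis by (rule edge[OF VQ[OF ij(1)] VP[OF ij(2)]]) (simp_all add: e)
  next
    assume "e \<in> {{Old v, Q i} |i. i \<in> {1..degree \<Gamma> v}}"
    then obtain i where i: "i \<in> {1..degree \<Gamma> v}" and e: "e = {Old v, Q i}" by blast
    show ?thesis by (rule edge[OF VO[OF v] VQ[OF i]]) (simp_all add: e)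
  next
    assume "e \<in> {{P i, Old (u i)} |i. i \<in> {1..degree \<Gamma> v}}"
    then obtain i where i: "i \<in> {1..degree \<Gamma> v}" and e: "e = {P i, Old (u i)}" by blast
    show ?thesis by (rule edge[OF VP[OF i] VO[OF uv(1)[OF i]]]) (simp_all add: e)
  qed
  moreover have "finite (verts ?F)"
    using G by (simp add: V signed_graph_def simple_graph_def)
  moreover have "sign (fowler \<Gamma> v u) e \<in> {-1, 1}" if "e \<in> edges ?F" for e
    using that unfolding E
  proof (elim UnE)
    assume "e \<in> (`) Old ` (edges \<Gamma> - {{v, u i} |i. i \<in> {1..degree \<Gamma> v}})"
    then obtain e0 where e0: "e0 \<in> edges \<Gamma>" "e = Old ` e0" by blast
    then show ?thesis using fowler_sign_old[OF e0(1)] G by (simp add: signed_graph_def)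
  next
    assume "e \<in> {{P i, Old (u i)} |i. i \<in> {1..degree \<Gamma> v}}"
    then obtain i where i: "e = {P i, Old (u i)}" "i \<in> {1..degree \<Gamma> v}" by blast
    then show ?thesis using fowler_sign_pu[OF i(2)] uv(2)[OF i(2)] G
      by (simp add: signed_graph_def)
  qed (auto simp: fowler_sign_vq fowler_sign_qp)
  ultimately show ?thesis
    by (simp add: signed_graph_def simple_graph_def fowler_def)
qed

end

theory Submission
  imports Defs
begin

text \<open>
  Write \<open>\<rho>\<close> for the degree of \<open>v\<close> and \<open>F\<close> for the Fowler construction. Everything about nullity
  follows from solving the kernel equations of \<open>F\<close> on the new vertices. Let \<open>y\<close> be in the kernel
  of \<open>F\<close>. The equation at \<open>Q i\<close> says that \<open>y (Old v)\<close> plus all the \<open>y (P j)\<close> with \<open>j \<noteq> i\<close> is zero;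
  comparing these equations shows that all \<open>y (P j)\<close> have one common value \<open>c\<close> and that
  \<open>y (Old v) = (1 - \<rho>) c\<close>. The equation at \<open>v\<close> says that the \<open>y (Q j)\<close> sum to zero, so the
  equation at \<open>P i\<close> collapses to \<open>y (Q i) = \<sigma>(v u\<^sub>i) y (Old (u i))\<close>. Substituting, the equation of \<open>F\<close>
  at \<open>u i\<close> is the equation of \<open>\<Gamma>\<close> at \<open>u i\<close> for the vector that has \<open>c\<close> at \<open>v\<close> and agrees with \<open>y\<close> on
  the other old vertices, and the vanishing sum of the \<open>y (Q i)\<close> is the equation of \<open>\<Gamma>\<close> at \<open>v\<close>.
  Hence the map \<open>lift\<close>, which reverses this, sends the kernel of \<open>\<Gamma>\<close> linearly and injectively
  onto that of \<open>F\<close> (\<open>kernel_F\<close>), and the nullities agree (\<open>nullity_F\<close>).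

  The lift of a full vector could only fail to be full through the factor \<open>1 - \<rho>\<close>, that is, for
  \<open>\<rho> = 1\<close>. But then the equation of \<open>\<Gamma>\<close> at the pendant vertex \<open>v\<close> makes every kernel vector vanish
  at its neighbour, so the kernel of \<open>\<Gamma>\<close> has no full vector anyway (\<open>full_lift\<close>).

  For balance, a signed graph is balanced exactly if its vertices can be two-coloured so that
  the negative edges are those with ends of different colours (\<open>sign_balanced_iff\<close>). The
  new edges other than \<open>P i -- u i\<close> are positive and the edge \<open>P i -- u i\<close> takes over the sign of
  \<open>v -- u i\<close>, so the vertices \<open>P i\<close> act as copies of \<open>v\<close> and colourings transfer both ways
  (\<open>sign_balanced_F\<close>).
\<close>

section \<open>Dimension under injective linear maps\<close>

text \<open>A basis of \<open>V\<close> is mapped to a basis of its image. The ambient spaces may have infinite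
  dimension, as the function space over an infinite vertex type does.\<close>

lemma dim_injective_linear_image:
  assumes "Vector_Spaces.linear s1 s2 f" and inj: "inj f"
  shows "vector_space.dim s2 (f ` V) = vector_space.dim s1 V"
proof -
  interpret f: Vector_Spaces.linear s1 s2 f by fact
  obtain B where B: "B \<subseteq> V" "f.vs1.independent B" "V \<subseteq> f.vs1.span B"
    using f.vs1.maximal_independent_subset by blast
  have span: "f.vs1.span B = f.vs1.span V"
    using B by (metis f.vs1.span_eq f.vs1.span_superset subset_trans)
  have "f.vs2.independent (f ` B)"
    using B(2) inj by (intro f.independent_injective_image) (auto intro: inj_on_subset)
  moreover have "f.vs2.span (f ` B) = f.vs2.span (f ` V)"
    by (simp add: f.span_image span)
  ultimately have "f.vs2.dim (f ` V) = card (f ` B)"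
    by (simp add: f.vs2.dim_eq_card)
  also have "\<dots> = card B"
    using inj by (intro card_image) (auto intro: inj_on_subset)
  also have "\<dots> = f.vs1.dim V"
    using f.vs1.dim_eq_card[OF span B(2)] by simp
  finally show ?thesis .
qed

section \<open>Sign balance as a two-colouring\<close>

lemma mem_boundary_doubleton:
  "{a, b} \<in> boundary G U \<longleftrightarrow> {a, b} \<in> edges G \<and> (a \<in> U \<longleftrightarrow> b \<notin> U)"
  unfolding boundary_def by (auto simp: doubleton_eq_iff)

text \<open>The colour class \<open>U\<close> is the set at which \<open>\<Gamma>\<close> is switched: switching there makes every edge
  positive exactly if the negative edges form the boundary of \<open>U\<close>. Vertices outside the graph
  lie on no edge, so their colours are irrelevant and \<open>U\<close> may be any set.\<close>

lemma sign_balanced_iff: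
  assumes "signed_graph \<Gamma>"
  shows "sign_balanced \<Gamma> \<longleftrightarrow>
    (\<exists>U. \<forall>a b. {a, b} \<in> edges \<Gamma> \<longrightarrow> (sign \<Gamma> {a, b} = -1 \<longleftrightarrow> (a \<in> U \<longleftrightarrow> b \<notin> U)))"
    (is "_ \<longleftrightarrow> (\<exists>U. ?col U)")
proof -
  have ends: "\<exists>a b. a \<in> verts \<Gamma> \<and> b \<in> verts \<Gamma> \<and> e = {a, b}" if "e \<in> edges \<Gamma>" for e
    using assms that unfolding signed_graph_def simple_graph_def by meson
  have in_verts: "a \<in> verts \<Gamma>" "b \<in> verts \<Gamma>" if "{a, b} \<in> edges \<Gamma>" for a b
    using ends[OF that] by (auto simp: doubleton_eq_iff)
  have col_iff: "neg_edges \<Gamma> = boundary \<Gamma> U \<longleftrightarrow> ?col U" for U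
  proof
    assume "neg_edges \<Gamma> = boundary \<Gamma> U"
    then have "{a, b} \<in> neg_edges \<Gamma> \<longleftrightarrow> {a, b} \<in> boundary \<Gamma> U" for a b
      by simp
    then show "?col U"
      unfolding mem_boundary_doubleton neg_edges_def mem_Collect_eq by blast
  next
    assume col: "?col U"
    have "e \<in> neg_edges \<Gamma> \<longleftrightarrow> e \<in> boundary \<Gamma> U" if e_edge: "e \<in> edges \<Gamma>" for e
    proof -
      obtain a b where e: "e = {a, b}" using ends[OF e_edge] by (elim exE conjE) (erule that)
      show ?thesis
        using col e_edge unfolding e mem_boundary_doubleton neg_edges_def by blast
    qed
    then show "neg_edges \<Gamma> = boundary \<Gamma> U"
      unfolding neg_edges_def boundary_def by blast
  qed
  have sub: "neg_edges \<Gamma> \<subseteq> edges \<Gamma>" "boundary \<Gamma> U \<subseteq> edges \<Gamma>" for U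
    by (auto simp: neg_edges_def boundary_def)
  have "same_sgraph (switch \<Gamma> U) (signed_by \<Gamma> {}) \<longleftrightarrow> neg_edges \<Gamma> = boundary \<Gamma> U" for U
  proof -
    have neg: "neg_edges (signed_by \<Gamma> S) = edges \<Gamma> \<inter> S" for S
      by (auto simp: neg_edges_def signed_by_def)
    have ve: "verts (signed_by \<Gamma> S) = verts \<Gamma>" "edges (signed_by \<Gamma> S) = edges \<Gamma>" for S
      by (simp_all add: signed_by_def)
    have "same_sgraph (switch \<Gamma> U) (signed_by \<Gamma> {})
        \<longleftrightarrow> edges \<Gamma> \<inter> sym_diff (neg_edges \<Gamma>) (boundary \<Gamma> U) = {}"
      unfolding same_sgraph_def switch_def neg ve by simp
    then show ?thesis using sub(1) sub(2)[of U] by blast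
  qed
  then have "sign_balanced \<Gamma> \<longleftrightarrow> (\<exists>U. U \<subseteq> verts \<Gamma> \<and> ?col U)"
    unfolding sign_balanced_def switching_equivalent_def col_iff[symmetric] by simp
  also have "\<dots> \<longleftrightarrow> (\<exists>U. ?col U)"
  proof
    assume "\<exists>U. ?col U"
    then obtain U where "?col U" by blast
    then have "?col (U \<inter> verts \<Gamma>)" using in_verts by (meson IntD1 IntI)
    then show "\<exists>U. U \<subseteq> verts \<Gamma> \<and> ?col U" by blast
  qed blast
  finally show ?thesis .
qed

section \<open>Edges of the Fowler construction\<close>

lemma adjacency_sym: "adjacency \<Gamma> a b = adjacency \<Gamma> b a"
  by (simp add: adjacency_def insert_commute)

text \<open>The entry at \<open>a\<close> of the product of the adjacency matrix with \<open>x\<close>; its vanishing is the kernel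
  equation at \<open>a\<close>.\<close>

definition row :: "'a sgraph \<Rightarrow> ('a \<Rightarrow> real) \<Rightarrow> 'a \<Rightarrow> real" where
  "row \<Gamma> x a = (\<Sum>b\<in>verts \<Gamma>. adjacency \<Gamma> a b * x b)"

lemma mem_kernel: "x \<in> kernel \<Gamma> \<longleftrightarrow>
    (\<forall>a. a \<notin> verts \<Gamma> \<longrightarrow> x a = 0) \<and> (\<forall>a\<in>verts \<Gamma>. row \<Gamma> x a = 0)"
  by (simp add: kernel_def row_def)

locale fowler_setting =
  fixes \<Gamma> :: "'a sgraph" and v :: 'a and u :: "nat \<Rightarrow> 'a"
  assumes signed: "signed_graph \<Gamma>"
    and v_in: "v \<in> verts \<Gamma>"
    and bij_u: "bij_betw u {1..degree \<Gamma> v} (neighbours \<Gamma> v)"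
begin

abbreviation \<rho> :: nat where "\<rho> \<equiv> degree \<Gamma> v"
abbreviation I :: "nat set" where "I \<equiv> {1..\<rho>}"
abbreviation F :: "'a fowler_vertex sgraph" where "F \<equiv> fowler \<Gamma> v u"

lemma finite_verts: "finite (verts \<Gamma>)"
  using signed by (simp add: signed_graph_def simple_graph_def)

lemma edge_neq: "a \<noteq> b"
  and edge_in_verts: "a \<in> verts \<Gamma>" "b \<in> verts \<Gamma>"
  if ab: "{a, b} \<in> edges \<Gamma>"
proof -
  have "\<forall>e\<in>edges \<Gamma>. \<exists>c\<in>verts \<Gamma>. \<exists>d\<in>verts \<Gamma>. c \<noteq> d \<and> e = {c, d}"
    using signed by (simp add: signed_graph_def simple_graph_def)
  from bspec[OF this ab] show "a \<noteq> b" "a \<in> verts \<Gamma>" "b \<in> verts \<Gamma>"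
    by (auto simp: doubleton_eq_iff)
qed

lemma u_edge: "{v, u i} \<in> edges \<Gamma>" "u i \<in> verts \<Gamma>" "u i \<noteq> v" if "i \<in> I"
proof -
  show "{v, u i} \<in> edges \<Gamma>" "u i \<in> verts \<Gamma>"
    using bij_betwE[OF bij_u] that by (auto simp: neighbours_def)
  then show "u i \<noteq> v" using edge_neq by metis
qed

lemma edge_at_v: "{v, b} \<in> edges \<Gamma> \<longleftrightarrow> (\<exists>i\<in>I. b = u i)"
  using bij_u edge_in_verts(2)[of v b] unfolding bij_betw_def neighbours_def by auto

lemma u_inj: "u i = u j \<longleftrightarrow> i = j" if "i \<in> I" "j \<in> I"
  using bij_u that unfolding bij_betw_def inj_on_def by blast

lemma verts_F: "verts F = Old ` verts \<Gamma> \<union> (Q ` I \<union> P ` I)"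
  by (auto simp: fowler_def fowler_graph_def Let_def)

lemma edges_F: "edges F = (`) Old ` (edges \<Gamma> - {{v, u i} |i. i \<in> I})
        \<union> {{Q i, P j} |i j. i \<in> I \<and> j \<in> I \<and> i \<noteq> j}
        \<union> {{Old v, Q i} |i. i \<in> I}
        \<union> {{P i, Old (u i)} |i. i \<in> I}"
  by (simp add: fowler_def fowler_graph_def Let_def)

text \<open>A copy of an old edge contains old vertices only.\<close>

lemma no_copy: "{Q i, z} \<notin> (`) Old ` E" "{P i, z} \<notin> (`) Old ` E"
  "{z, Q i} \<notin> (`) Old ` E" "{z, P i} \<notin> (`) Old ` E"
  for z :: "'a fowler_vertex" and E :: "'a set set"
proof -
  have new: "e \<notin> (`) Old ` E" if "x \<in> e" "x \<notin> range Old"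
    for x and e :: "'a fowler_vertex set" and E :: "'a set set"
    using that by blast
  show "{Q i, z} \<notin> (`) Old ` E" "{z, Q i} \<notin> (`) Old ` E"
    by (rule new[of "Q i"]; auto)+
  show "{P i, z} \<notin> (`) Old ` E" "{z, P i} \<notin> (`) Old ` E"
    by (rule new[of "P i"]; auto)+
qed

lemma copy_iff: "{Old a, Old b} \<in> (`) Old ` E \<longleftrightarrow> {a, b} \<in> E" for a b :: 'a
proof -
  have "inj ((`) (Old :: 'a \<Rightarrow> 'a fowler_vertex))"
    by (intro inj_on_image) (simp add: inj_on_def)
  from inj_image_mem_iff[OF this, of "{a, b}" E] show ?thesis by simp
qed

lemma edge_Old_Old:
  "{Old a, Old b} \<in> edges F \<longleftrightarrow> {a, b} \<in> edges \<Gamma> \<and> a \<noteq> v \<and> b \<noteq> v"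
proof -
  have "{Old a, Old b} \<notin> {{Q i, P j} |i j. i \<in> I \<and> j \<in> I \<and> i \<noteq> j}"
    "{Old a, Old b} \<notin> {{Old v, Q i} |i. i \<in> I}"
    "{Old a, Old b} \<notin> {{P i, Old (u i)} |i. i \<in> I}"
    by (auto simp: doubleton_eq_iff)
  then have "{Old a, Old b} \<in> edges F \<longleftrightarrow> {a, b} \<in> edges \<Gamma> - {{v, u i} |i. i \<in> I}"
    unfolding edges_F Un_iff copy_iff by blast
  also have "\<dots> \<longleftrightarrow> {a, b} \<in> edges \<Gamma> \<and> \<not> (a = v \<and> (\<exists>i\<in>I. b = u i) \<or> b = v \<and> (\<exists>i\<in>I. a = u i))"
    by (auto simp: doubleton_eq_iff)
  also have "\<dots> \<longleftrightarrow> {a, b} \<in> edges \<Gamma> \<and> a \<noteq> v \<and> b \<noteq> v"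
    unfolding edge_at_v[symmetric] by (metis insert_commute)
  finally show ?thesis .
qed

lemma edge_Old_Q: "{Old a, Q i} \<in> edges F \<longleftrightarrow> a = v \<and> i \<in> I"
  unfolding edges_F by (simp add: no_copy) (auto simp: doubleton_eq_iff)

lemma edge_Old_P: "{Old a, P i} \<in> edges F \<longleftrightarrow> i \<in> I \<and> a = u i"
  unfolding edges_F by (simp add: no_copy) (auto simp: doubleton_eq_iff)

lemma edge_Q_P: "{Q i, P j} \<in> edges F \<longleftrightarrow> i \<in> I \<and> j \<in> I \<and> i \<noteq> j"
  unfolding edges_F by (simp add: no_copy) (auto simp: doubleton_eq_iff)

lemma edge_Q_Q: "{Q i, Q j} \<notin> edges F"
  unfolding edges_F by (simp add: no_copy) (auto simp: doubleton_eq_iff)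

lemma edge_P_P: "{P i, P j} \<notin> edges F"
  unfolding edges_F by (simp add: no_copy) (auto simp: doubleton_eq_iff)

lemma sign_Old_Old: "sign F {Old a, Old b} = sign \<Gamma> {a, b}" if "{a, b} \<in> edges \<Gamma>"
  using fowler_sign_old[OF that] by simp

lemma sign_Old_P: "sign F {Old (u i), P i} = sign \<Gamma> {v, u i}" if "i \<in> I"
  using fowler_sign_pu[OF that] by (simp add: insert_commute)

lemma adjacency_F:
  "adjacency F (Old a) (Old b) = (if a = v \<or> b = v then 0 else adjacency \<Gamma> a b)"
  "adjacency F (Old a) (Q i) = (if a = v \<and> i \<in> I then 1 else 0)"
  "adjacency F (Old a) (P i) = (if i \<in> I \<and> a = u i then adjacency \<Gamma> v a else 0)"
  "adjacency F (Q i) (P j) = (if i \<in> I \<and> j \<in> I \<and> i \<noteq> j then 1 else 0)"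
  "adjacency F (Q i) (Q j) = 0"
  "adjacency F (P i) (P j) = 0"
  using u_edge(1) unfolding adjacency_def
  by (auto simp: edge_Old_Old edge_Old_Q edge_Old_P edge_Q_P edge_Q_Q edge_P_P
      sign_Old_Old sign_Old_P fowler_sign_vq fowler_sign_qp)

lemma adjacency_v_square: "adjacency \<Gamma> v (u i) * adjacency \<Gamma> v (u i) = 1" if "i \<in> I"
proof -
  have "sign \<Gamma> {v, u i} \<in> {-1, 1}"
    using signed u_edge(1)[OF that] unfolding signed_graph_def by blast
  then show ?thesis using u_edge(1)[OF that] by (auto simp: adjacency_def)
qed

section \<open>Kernel equations\<close>

lemma row_F: "row F y z = (\<Sum>b\<in>verts \<Gamma>. adjacency F z (Old b) * y (Old b))
    + (\<Sum>i\<in>I. adjacency F z (Q i) * y (Q i)) + (\<Sum>i\<in>I. adjacency F z (P i) * y (P i))"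
proof -
  have inj: "inj_on Old (verts \<Gamma>)" "inj_on Q I" "inj_on P I"
    by (auto simp: inj_on_def)
  have disj: "Old ` verts \<Gamma> \<inter> (Q ` I \<union> P ` I) = {}" "Q ` I \<inter> P ` I = {}"
    by auto
  have "row F y z = (\<Sum>w\<in>Old ` verts \<Gamma>. adjacency F z w * y w)
      + ((\<Sum>w\<in>Q ` I. adjacency F z w * y w) + (\<Sum>w\<in>P ` I. adjacency F z w * y w))"
    unfolding row_def verts_F using finite_verts
    by (simp add: sum.union_disjoint[OF _ _ disj(1)] sum.union_disjoint[OF _ _ disj(2)]
        del: One_nat_def)
  then show ?thesis
    unfolding sum.reindex[OF inj(1)] sum.reindex[OF inj(2)] sum.reindex[OF inj(3)] by simp
qed

lemma row_Old_v: "row F y (Old v) = (\<Sum>i\<in>I. y (Q i))"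
proof -
  have "(\<Sum>i\<in>I. adjacency F (Old v) (P i) * y (P i)) = 0"
    by (intro sum.neutral) (use u_edge(3) in \<open>force simp: adjacency_F\<close>)
  then show ?thesis by (simp add: row_F adjacency_F)
qed

lemma row_Q: "row F y (Q i) = y (Old v) + (\<Sum>j\<in>I - {i}. y (P j))" if "i \<in> I"
proof -
  have "(\<Sum>b\<in>verts \<Gamma>. adjacency F (Q i) (Old b) * y (Old b))
      = (\<Sum>b\<in>verts \<Gamma>. if b = v then y (Old v) else 0)"
    using that by (intro sum.cong) (auto simp: adjacency_sym[of F "Q i"] adjacency_F)
  moreover have "(\<Sum>j\<in>I. adjacency F (Q i) (P j) * y (P j)) = (\<Sum>j\<in>I - {i}. y (P j))"
    using that by (intro sum.mono_neutral_cong_right) (auto simp: adjacency_F)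
  ultimately show ?thesis
    using finite_verts v_in by (simp add: row_F adjacency_F)
qed

lemma row_P: "row F y (P i) = adjacency \<Gamma> v (u i) * y (Old (u i)) + (\<Sum>j\<in>I - {i}. y (Q j))"
  if "i \<in> I"
proof -
  have "(\<Sum>b\<in>verts \<Gamma>. adjacency F (P i) (Old b) * y (Old b))
      = (\<Sum>b\<in>verts \<Gamma>. if b = u i then adjacency \<Gamma> v (u i) * y (Old (u i)) else 0)"
    using that by (intro sum.cong) (auto simp: adjacency_sym[of F "P i"] adjacency_F)
  moreover have "(\<Sum>j\<in>I. adjacency F (P i) (Q j) * y (Q j)) = (\<Sum>j\<in>I - {i}. y (Q j))"
    using that by (intro sum.mono_neutral_cong_right)
      (auto simp: adjacency_sym[of F "P i"] adjacency_F)
  ultimately show ?thesis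
    using finite_verts u_edge(2)[OF that] by (simp add: row_F adjacency_F)
qed

lemma row_v: "row \<Gamma> x v = (\<Sum>i\<in>I. adjacency \<Gamma> v (u i) * x (u i))"
proof -
  have "row \<Gamma> x v = (\<Sum>b\<in>neighbours \<Gamma> v. adjacency \<Gamma> v b * x b)"
    unfolding row_def neighbours_def using finite_verts
    by (intro sum.mono_neutral_right) (auto simp: adjacency_def)
  also have "\<dots> = (\<Sum>i\<in>I. adjacency \<Gamma> v (u i) * x (u i))"
    using sum.reindex_bij_betw[OF bij_u, of "\<lambda>b. adjacency \<Gamma> v b * x b"] by simp
  finally show ?thesis .
qed

text \<open>Away from \<open>v\<close> the common value on the vertices \<open>P i\<close> plays the role of the entry at \<open>v\<close>: a
  neighbour \<open>u i\<close> of \<open>v\<close> has lost its edge to \<open>v\<close> but has an edge of the same sign to \<open>P i\<close>.\<close>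

lemma row_Old:
  assumes a: "a \<noteq> v"
    and P: "\<And>i. i \<in> I \<Longrightarrow> y (P i) = x v"
    and Old: "\<And>b. b \<in> verts \<Gamma> \<Longrightarrow> b \<noteq> v \<Longrightarrow> y (Old b) = x b"
  shows "row F y (Old a) = row \<Gamma> x a"
proof -
  have "(\<Sum>i\<in>I. adjacency F (Old a) (P i) * y (P i)) = adjacency \<Gamma> a v * x v"
  proof (cases "\<exists>i\<in>I. a = u i")
    case True
    then obtain i where i: "i \<in> I" "a = u i" by blast
    have "(\<Sum>j\<in>I. adjacency F (Old a) (P j) * y (P j))
        = (\<Sum>j\<in>I. if j = i then adjacency \<Gamma> v a * x v else 0)"
      using i by (intro sum.cong) (auto simp: adjacency_F P u_inj)
    then show ?thesis using i adjacency_sym[of \<Gamma> a v] by simp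
  next
    case False
    then have "adjacency \<Gamma> a v = 0"
      using edge_at_v[of a] by (simp add: adjacency_def insert_commute)
    moreover have "(\<Sum>i\<in>I. adjacency F (Old a) (P i) * y (P i)) = 0"
      using False by (intro sum.neutral) (auto simp: adjacency_F)
    ultimately show ?thesis by simp
  qed
  moreover have "(\<Sum>b\<in>verts \<Gamma>. adjacency F (Old a) (Old b) * y (Old b))
      = (\<Sum>b\<in>verts \<Gamma> - {v}. adjacency \<Gamma> a b * x b)"
    using a finite_verts Old by (intro sum.mono_neutral_cong_right) (auto simp: adjacency_F)
  moreover have "row \<Gamma> x a = adjacency \<Gamma> a v * x v + (\<Sum>b\<in>verts \<Gamma> - {v}. adjacency \<Gamma> a b * x b)"
    unfolding row_def using finite_verts v_in by (rule sum.remove)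
  ultimately show ?thesis using a by (simp add: row_F adjacency_F)
qed

section \<open>The isomorphism of kernels\<close>

text \<open>The factor \<open>1 - \<rho>\<close> balances the equation at \<open>Q i\<close>, which sees the other \<open>\<rho> - 1\<close> vertices \<open>P j\<close>.
  For \<open>\<rho> = 0\<close> it is \<open>1\<close>, as it has to be, since \<open>F\<close> is then a copy of \<open>\<Gamma>\<close>.\<close>

definition lift :: "('a \<Rightarrow> real) \<Rightarrow> 'a fowler_vertex \<Rightarrow> real" where
  "lift x z = (case z of
      Old w \<Rightarrow> (if w = v then (1 - real \<rho>) * x v else x w)
    | Q i \<Rightarrow> (if i \<in> I then adjacency \<Gamma> v (u i) * x (u i) else 0)
    | P i \<Rightarrow> (if i \<in> I then x v else 0))"

lemma lift_simps:
  "lift x (Old v) = (1 - real \<rho>) * x v"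
  "w \<noteq> v \<Longrightarrow> lift x (Old w) = x w"
  "i \<in> I \<Longrightarrow> lift x (Q i) = adjacency \<Gamma> v (u i) * x (u i)"
  "i \<in> I \<Longrightarrow> lift x (P i) = x v"
  by (simp_all add: lift_def)

lemma linear_lift: "Vector_Spaces.linear scale_fun scale_fun lift"
proof -
  interpret A: vector_space "scale_fun :: real \<Rightarrow> ('a \<Rightarrow> real) \<Rightarrow> _"
    by (rule vector_space_scale_fun)
  interpret B: vector_space "scale_fun :: real \<Rightarrow> ('a fowler_vertex \<Rightarrow> real) \<Rightarrow> _"
    by (rule vector_space_scale_fun)
  show ?thesis
    by unfold_locales
      (auto simp: lift_def scale_fun_def fun_eq_iff algebra_simps split: fowler_vertex.split)
qed

text \<open>The entry at \<open>v\<close> is recovered from \<open>Old v\<close> unless the factor \<open>1 - \<rho>\<close> vanishes, in which case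
  \<open>P 1\<close> exists and carries it.\<close>

lemma inj_lift: "inj lift"
proof (rule injI, rule ext)
  fix x x' w assume eq: "lift x = lift x'"
  show "x w = x' w"
  proof (cases "w = v")
    case False
    then show ?thesis using lift_simps(2)[of w] eq by metis
  next
    case True
    show ?thesis
    proof (cases "\<rho> = 1")
      case one: True
      then have "1 \<in> I" by simp
      then show ?thesis using lift_simps(4)[of 1] eq True by metis
    next
      case False
      then have "1 - real \<rho> \<noteq> 0" by simp
      then show ?thesis using lift_simps(1) eq True by (metis mult_cancel_left)
    qed
  qed
qed

lemma lift_in_kernel:
  assumes "x \<in> kernel \<Gamma>"
  shows "lift x \<in> kernel F"
proof -
  have zero: "row \<Gamma> x a = 0" if "a \<in> verts \<Gamma>" for a
    using assms that by (simp add: mem_kernel)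
  have sum_q: "(\<Sum>i\<in>I. lift x (Q i)) = 0"
    using zero[OF v_in] by (simp add: row_v lift_simps)
  have "lift x z = 0" if "z \<notin> verts F" for z
  proof (cases z)
    case (Old w)
    then have "w \<notin> verts \<Gamma>" using that by (auto simp: verts_F)
    then show ?thesis using assms v_in Old by (auto simp: lift_def mem_kernel)
  qed (use that in \<open>auto simp: lift_def verts_F\<close>)
  moreover have "row F (lift x) z = 0" if z: "z \<in> verts F" for z
  proof (cases z)
    case (Old a)
    have "row F (lift x) (Old a) = row \<Gamma> x a" if "a \<noteq> v"
      using that by (intro row_Old) (auto simp: lift_simps)
    then show ?thesis
      using Old z zero sum_q by (cases "a = v") (auto simp: row_Old_v verts_F)
  next
    case (Q i)
    then have i: "i \<in> I" using z by (auto simp: verts_F)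
    have "(\<Sum>j\<in>I - {i}. lift x (P j)) = (real \<rho> - 1) * x v"
      using i by (simp add: lift_simps of_nat_diff)
    then show ?thesis using Q i by (simp add: row_Q lift_simps algebra_simps)
  next
    case (P i)
    then have i: "i \<in> I" using z by (auto simp: verts_F)
    have "lift x (Q i) + (\<Sum>j\<in>I - {i}. lift x (Q j)) = 0"
      using sum_q i sum.remove[of I i "\<lambda>i. lift x (Q i)"] by simp
    then show ?thesis using P i u_edge(3)[OF i] by (simp add: row_P lift_simps)
  qed
  ultimately show ?thesis by (simp add: mem_kernel)
qed

text \<open>The kernel equations at \<open>Q i\<close>, \<open>v\<close> and \<open>P i\<close>, in this order, determine \<open>y\<close> on the new vertices
  and at \<open>v\<close>.\<close>

lemma kernel_F_subset:
  assumes y: "y \<in> kernel F"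
  shows "y \<in> lift ` kernel \<Gamma>"
proof -
  have row0: "row F y z = 0" if "z \<in> verts F" for z
    using y that by (simp add: mem_kernel)
  have out: "y z = 0" if "z \<notin> verts F" for z
    using y that by (simp add: mem_kernel)
  have inF: "Old a \<in> verts F \<longleftrightarrow> a \<in> verts \<Gamma>" "Q i \<in> verts F \<longleftrightarrow> i \<in> I" "P i \<in> verts F \<longleftrightarrow> i \<in> I" for a i
    by (auto simp: verts_F)
  \<comment> \<open>With this \<open>c\<close> the argument needs no separate case \<open>\<rho> = 0\<close>: there is no \<open>P i\<close> then, and
    \<open>c = y (Old v)\<close>.\<close>
  define S where "S = (\<Sum>i\<in>I. y (P i))"
  define c where "c = y (Old v) + S"
  have P: "y (P i) = c" if i: "i \<in> I" for i
  proof -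
    have "S = y (P i) + (\<Sum>j\<in>I - {i}. y (P j))"
      unfolding S_def using i by (intro sum.remove) auto
    moreover have "y (Old v) + (\<Sum>j\<in>I - {i}. y (P j)) = 0"
      using row0[of "Q i"] i by (simp add: inF row_Q)
    ultimately show ?thesis by (simp add: c_def)
  qed
  have "S = real \<rho> * c" unfolding S_def using P by simp
  then have v: "y (Old v) = (1 - real \<rho>) * c"
    by (simp add: c_def algebra_simps)
  have sum_q: "(\<Sum>i\<in>I. y (Q i)) = 0"
    using row0[of "Old v"] v_in by (simp add: inF row_Old_v)
  have Q: "y (Q i) = adjacency \<Gamma> v (u i) * y (Old (u i))" if i: "i \<in> I" for i
  proof -
    have "y (Q i) + (\<Sum>j\<in>I - {i}. y (Q j)) = 0"
      using sum_q i sum.remove[of I i "\<lambda>i. y (Q i)"] by simp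
    moreover have "adjacency \<Gamma> v (u i) * y (Old (u i)) + (\<Sum>j\<in>I - {i}. y (Q j)) = 0"
      using row0[of "P i"] i by (simp add: inF row_P)
    ultimately show ?thesis by simp
  qed
  define x where "x w = (if w = v then c else y (Old w))" for w
  have "x a = 0" if "a \<notin> verts \<Gamma>" for a
    using that out[of "Old a"] v_in by (auto simp: x_def inF)
  moreover have "row \<Gamma> x a = 0" if "a \<in> verts \<Gamma>" for a
  proof (cases "a = v")
    case True
    have "row \<Gamma> x v = (\<Sum>i\<in>I. y (Q i))"
      unfolding row_v using u_edge(3) by (intro sum.cong) (auto simp: x_def Q)
    then show ?thesis using sum_q True by simp
  next
    case False
    then have "row F y (Old a) = row \<Gamma> x a"
      by (intro row_Old) (auto simp: x_def P)
    then show ?thesis using row0[of "Old a"] that by (simp add: inF)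
  qed
  ultimately have "x \<in> kernel \<Gamma>" by (simp add: mem_kernel)
  moreover have "y z = lift x z" for z
    using v P Q u_edge(3) out[of z]
    by (cases z) (auto simp: lift_def x_def inF)
  ultimately show ?thesis by blast
qed

lemma kernel_F: "kernel F = lift ` kernel \<Gamma>"
  using lift_in_kernel kernel_F_subset by blast

lemma nullity_F: "nullity F = nullity \<Gamma>"
  unfolding nullity_def kernel_F by (rule dim_injective_linear_image[OF linear_lift inj_lift])

text \<open>A pendant \<open>v\<close> forces every kernel vector to vanish at its only neighbour.\<close>

lemma full_degree_neq_1:
  assumes x: "x \<in> kernel \<Gamma>" and full: "full \<Gamma> x"
  shows "\<rho> \<noteq> 1"
proof
  assume one: "\<rho> = 1"
  have "row \<Gamma> x v = 0" using x v_in by (simp add: mem_kernel)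
  then have "adjacency \<Gamma> v (u 1) * x (u 1) = 0" by (simp add: row_v one)
  moreover have "x (u 1) \<noteq> 0" using full u_edge(2)[of 1] one by (simp add: full_def)
  ultimately show False using adjacency_v_square[of 1] one by simp
qed

text \<open>A nonzero entry of the lift at \<open>Old v\<close> forces \<open>x v \<noteq> 0\<close>; conversely only the factor \<open>1 - \<rho>\<close>
  could introduce a zero.\<close>

lemma full_lift:
  assumes x: "x \<in> kernel \<Gamma>"
  shows "full F (lift x) \<longleftrightarrow> full \<Gamma> x"
proof
  assume full: "full F (lift x)"
  show "full \<Gamma> x"
    unfolding full_def
  proof
    fix a assume "a \<in> verts \<Gamma>"
    then have "lift x (Old a) \<noteq> 0" using full by (auto simp: full_def verts_F)
    then show "x a \<noteq> 0" by (auto simp: lift_def split: if_splits)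
  qed
next
  assume full: "full \<Gamma> x"
  have "1 - real \<rho> \<noteq> 0" using full_degree_neq_1[OF x full] by simp
  moreover have "adjacency \<Gamma> v (u i) \<noteq> 0" if "i \<in> I" for i
    using adjacency_v_square[OF that] by auto
  ultimately show "full F (lift x)"
    using full v_in u_edge(2) unfolding full_def verts_F by (auto simp: lift_def split: if_splits)
qed

lemma signed_nut_F: "signed_nut F \<longleftrightarrow> signed_nut \<Gamma>"
  using signed signed_graph_fowler[OF signed v_in bij_u] full_lift
  by (auto simp: signed_nut_def nullity_F kernel_F)

section \<open>Transfer of balance\<close>

text \<open>A colouring of \<open>\<Gamma>\<close> extends by giving all new vertices the colour of \<open>v\<close>. In the other
  direction \<open>v\<close> must be given the colour of the vertices \<open>P i\<close>, not that of \<open>Old v\<close>: if \<open>\<rho> = 1\<close>,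
  no edge joins \<open>P 1\<close> to \<open>Q 1\<close>, and the two colours may differ.\<close>

lemma sign_balanced_F: "sign_balanced F \<longleftrightarrow> sign_balanced \<Gamma>"
proof
  assume "sign_balanced \<Gamma>"
  then obtain U where U: "\<And>a b. {a, b} \<in> edges \<Gamma> \<Longrightarrow> sign \<Gamma> {a, b} = -1 \<longleftrightarrow> (a \<in> U \<longleftrightarrow> b \<notin> U)"
    using sign_balanced_iff[OF signed] by blast
  define W where "W = {z. case z of Old a \<Rightarrow> a \<in> U | _ \<Rightarrow> v \<in> U}"
  have W: "Old a \<in> W \<longleftrightarrow> a \<in> U" "Q i \<in> W \<longleftrightarrow> v \<in> U" "P i \<in> W \<longleftrightarrow> v \<in> U" for a i
    by (simp_all add: W_def)
  have OO: "sign F {Old a, Old b} = -1 \<longleftrightarrow> (Old a \<in> W \<longleftrightarrow> Old b \<notin> W)"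
    if "{Old a, Old b} \<in> edges F" for a b
    using that U[of a b] by (simp add: edge_Old_Old sign_Old_Old W)
  have OQ: "sign F {Old a, Q i} = -1 \<longleftrightarrow> (Old a \<in> W \<longleftrightarrow> Q i \<notin> W)"
    if "{Old a, Q i} \<in> edges F" for a i
    using that by (simp add: edge_Old_Q fowler_sign_vq W)
  have OP: "sign F {Old a, P i} = -1 \<longleftrightarrow> (Old a \<in> W \<longleftrightarrow> P i \<notin> W)"
    if "{Old a, P i} \<in> edges F" for a i
    using that U[OF u_edge(1)[of i]] by (auto simp: edge_Old_P sign_Old_P W)
  have QP: "sign F {Q i, P j} = -1 \<longleftrightarrow> (Q i \<in> W \<longleftrightarrow> P j \<notin> W)" for i j
    by (simp add: fowler_sign_qp W)
  have "sign F {y, z} = -1 \<longleftrightarrow> (y \<in> W \<longleftrightarrow> z \<notin> W)" if yz: "{y, z} \<in> edges F" for y z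
  proof (cases y)
    case (Old a)
    then show ?thesis using yz OO OQ OP by (cases z) auto
  next
    case (Q i)
    then show ?thesis
      using yz OQ[of _ i] QP[of i] edge_Q_Q by (cases z) (auto simp: insert_commute)
  next
    case (P i)
    then show ?thesis
      using yz OP[of _ i] QP[of _ i] edge_P_P by (cases z) (auto simp: insert_commute)
  qed
  then show "sign_balanced F"
    using sign_balanced_iff[OF signed_graph_fowler[OF signed v_in bij_u]] by blast
next
  assume "sign_balanced F"
  then obtain W where W: "\<And>y z. {y, z} \<in> edges F \<Longrightarrow> sign F {y, z} = -1 \<longleftrightarrow> (y \<in> W \<longleftrightarrow> z \<notin> W)"
    using sign_balanced_iff[OF signed_graph_fowler[OF signed v_in bij_u]] by blast
  have vQ: "Q i \<in> W \<longleftrightarrow> Old v \<in> W" if "i \<in> I" for i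
    using W[of "Old v" "Q i"] that by (auto simp: edge_Old_Q fowler_sign_vq)
  have QP: "Q i \<in> W \<longleftrightarrow> P j \<in> W" if "i \<in> I" "j \<in> I" "i \<noteq> j" for i j
    using W[of "Q i" "P j"] that by (auto simp: edge_Q_P fowler_sign_qp)
  \<comment> \<open>Two different \<open>P i\<close>, \<open>P j\<close> are joined by the positive path through \<open>Q j\<close>, \<open>Old v\<close> and \<open>Q i\<close>.\<close>
  have PP: "P i \<in> W \<longleftrightarrow> P j \<in> W" if "i \<in> I" "j \<in> I" for i j
    using that vQ QP by (cases "i = j") metis+
  define U where "U = {a. if a = v then P 1 \<in> W else Old a \<in> W}"
  have at_v: "sign \<Gamma> {v, b} = -1 \<longleftrightarrow> (v \<in> U \<longleftrightarrow> b \<notin> U)" if b: "{v, b} \<in> edges \<Gamma>" for b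
  proof -
    obtain i where i: "i \<in> I" "b = u i" using b edge_at_v by blast
    then have "1 \<in> I" by auto
    then have "v \<in> U \<longleftrightarrow> P i \<in> W" using PP[OF i(1) \<open>1 \<in> I\<close>] by (simp add: U_def)
    moreover have "b \<in> U \<longleftrightarrow> Old b \<in> W" using u_edge(3) i by (simp add: U_def)
    moreover have "sign \<Gamma> {v, b} = -1 \<longleftrightarrow> (Old b \<in> W \<longleftrightarrow> P i \<notin> W)"
      using W[of "Old b" "P i"] i by (simp add: edge_Old_P sign_Old_P)
    ultimately show ?thesis by blast
  qed
  have "sign \<Gamma> {a, b} = -1 \<longleftrightarrow> (a \<in> U \<longleftrightarrow> b \<notin> U)" if ab: "{a, b} \<in> edges \<Gamma>" for a b
  proof -
    consider "a = v" | "b = v" | "a \<noteq> v" "b \<noteq> v" by blast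
    then show ?thesis
    proof cases
      case 1 then show ?thesis using at_v ab by simp
    next
      case 2
      then have "{v, a} \<in> edges \<Gamma>" "{a, b} = {v, a}" using ab by (auto simp: insert_commute)
      then show ?thesis using at_v[of a] 2 by auto
    next
      case 3
      then show ?thesis using W[of "Old a" "Old b"] ab
        by (simp add: edge_Old_Old sign_Old_Old U_def)
    qed
  qed
  then show "sign_balanced \<Gamma>" using sign_balanced_iff[OF signed] by blast
qed

end

theorem corollary19:
  fixes \<Gamma> :: "'a sgraph" and v :: 'a and u :: "nat \<Rightarrow> 'a"
  assumes "signed_graph \<Gamma>"
    and "v \<in> verts \<Gamma>"
    and "bij_betw u {1..degree \<Gamma> v} (neighbours \<Gamma> v)"
  shows "(signed_nut (fowler \<Gamma> v u) \<longleftrightarrow> signed_nut \<Gamma>) \<and>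
         (sign_balanced_nut (fowler \<Gamma> v u) \<longleftrightarrow> sign_balanced_nut \<Gamma>)"
proof -
  interpret fowler_setting \<Gamma> v u
    using assms by unfold_locales
  show ?thesis
    unfolding sign_balanced_nut_def signed_nut_F sign_balanced_F by simp
qed

end
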